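(* Let $\mathtt{k}>0$ be fixed. Then the following statements hold. (i) If $\nu \ge \mu > -\frac{3\mathtt{k}}{2}$, then the function $x \mapsto \mathcal{L}_{\mu}^{\mathtt{k}}(x)/\mathcal{L}_{\nu}^{\mathtt{k}}(x)$ is increasing on $\mathbb{R}$. (ii) The function $\nu \mapsto \mathcal{L}_{\nu}^{\mathtt{k}}(x)$ is decreasing on $(-\frac{3\mathtt{k}}{2},\infty)$ for each fixed $x\in[0,\infty)$, and increasing on $(-\frac{3\mathtt{k}}{2},\infty)$ for each fixed $x\in(-\infty,0)$. Also, the function $\nu \mapsto \mathcal{L}_{\nu}^{\mathtt{k}}(x)$ is log-convex on $(-\frac{3\mathtt{k}}{2},\infty)$ for each fixed $x>0$. (iii) The function $\nu \mapsto L_{\nu+\mathtt{k}}^{\mathtt{k}}(x)/L_{\nu}^{\mathtt{k}}(x)$ is decreasing on $(-\frac{3\mathtt{k}}{2},\infty)$ for each fixed $x>0$.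
   Context: For $\mathtt{k}>0$, the $\mathtt{k}$-gamma function is $\Gamma_{\mathtt{k}}(x)=\int_0^\infty t^{x-1}e^{-t^{\mathtt{k}}/\mathtt{k}}\,dt$ for $\Re(x)>0$; $\Gamma$ is the usual gamma function. For real $\nu>-\frac{3\mathtt{k}}{2}$ and $x>0$, the modified $\mathtt{k}$-Struve function is $$L_{\nu}^{\mathtt{k}}(x)=\sum_{r=0}^{\infty}\frac{1}{\Gamma_{\mathtt{k}}\left(r\mathtt{k}+\nu+\frac{3\mathtt{k}}{2}\right)\Gamma\left(r+\frac32\right)}\left(\frac{x}{2}\right)^{2r+\frac{\nu}{\mathtt{k}}+1}.$$ Its normalization, defined for all $x\in\mathbb{R}$ by a power series, is $$\mathcal{L}_{\nu}^{\mathtt{k}}(x)=\sum_{r=0}^\infty f_r(\nu,\mathtt{k})\,x^{2r+1},\qquad f_r(\nu,\mathtt{k})=\frac{\Gamma_{\mathtt{k}}\left(\nu+\frac{3\mathtt{k}}{2}\right)}{\Gamma_{\mathtt{k}}\left(r\mathtt{k}+\nu+\frac{3\mathtt{k}}{2}\right)\Gamma\left(r+\frac32\right)2^{2r+1}},$$ so that $\mathcal{L}_{\nu}^{\mathtt{k}}(x)=\left(\frac{2}{x}\right)^{\nu/\mathtt{k}}\Gamma_{\mathtt{k}}\left(\nu+\frac{3\mathtt{k}}{2}\right)L_{\nu}^{\mathtt{k}}(x)$ for $x>0$. "Increasing" and "decreasing" are meant in the non-strict sense. A positive function $g$ on an interval is log-convex if $\log g$ is convex.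
   Formalization: In (i), the quotient is even in x, so "increasing on ℝ" fails whenever ν > μ; what is proved is that it is increasing on [0,∞) and decreasing on (−∞,0], its value at x = 0 (otherwise 0/0) being taken as the limit there. *)

theory Defs
  imports "HOL-Analysis.Analysis"
begin

text \<open>Only real arguments of the k-gamma function occur, so it is defined on the reals.\<close>

definition k_Gamma :: "real \<Rightarrow> real \<Rightarrow> real" where
  "k_Gamma k x = (LBINT t:{0<..}. t powr (x - 1) * exp (- (t powr k / k)))"

definition mod_struve :: "real \<Rightarrow> real \<Rightarrow> real \<Rightarrow> real" where
  "mod_struve k \<nu> x =
     (\<Sum>r::nat. 1 / (k_Gamma k (real r * k + \<nu> + 3 * k / 2) * Gamma (real r + 3 / 2))
        * (x / 2) powr (2 * real r + \<nu> / k + 1))"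

definition struve_coeff :: "real \<Rightarrow> real \<Rightarrow> nat \<Rightarrow> real" where
  "struve_coeff k \<nu> r =
     k_Gamma k (\<nu> + 3 * k / 2)
       / (k_Gamma k (real r * k + \<nu> + 3 * k / 2) * Gamma (real r + 3 / 2) * 2 ^ (2 * r + 1))"

definition norm_struve :: "real \<Rightarrow> real \<Rightarrow> real \<Rightarrow> real" where
  "norm_struve k \<nu> x = (\<Sum>r. struve_coeff k \<nu> r * x ^ (2 * r + 1))"

text \<open>Both normalized functions vanish at \<open>0\<close>, so their quotient has to be extended there by
  continuity; the library convention \<open>0 / 0 = 0\<close> would give a wrong value.
  The quotient is an even function of \<open>x\<close>, being a quotient of two odd power series; hence it can
  only be increasing on the nonnegative half-line, and it is decreasing on the nonpositive one.\<close>

definition norm_struve_quot :: "real \<Rightarrow> real \<Rightarrow> real \<Rightarrow> real \<Rightarrow> real" where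
  "norm_struve_quot k \<mu> \<nu> x =
     (if x = 0 then Lim (at 0) (\<lambda>t. norm_struve k \<mu> t / norm_struve k \<nu> t)
      else norm_struve k \<mu> x / norm_struve k \<nu> x)"

definition log_convex_on :: "real set \<Rightarrow> (real \<Rightarrow> real) \<Rightarrow> bool" where
  "log_convex_on S g \<longleftrightarrow> (\<forall>s\<in>S. 0 < g s) \<and> convex_on S (\<lambda>s. ln (g s))"

end

theory Submission
  imports Defs
begin

text \<open>
  Write \<open>a = \<nu> + 3 * k / 2\<close>, which is positive.  The functional equation
  \<open>\<Gamma>\<^sub>k(x + k) = x * \<Gamma>\<^sub>k(x)\<close> removes the k-gamma function from the coefficients: they become
  \<open>w\<^sub>r / (a)\<^sub>r\<close>, where \<open>(a)\<^sub>r = a * (a + k) * \<dots> * (a + (r - 1) * k)\<close> and the weight \<open>w\<^sub>r\<close> does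
  not depend on the order \<open>\<nu>\<close>.  With \<open>S(\<nu>, y) = (\<Sum>r. w\<^sub>r / (a)\<^sub>r * y ^ r)\<close> the normalized
  function is \<open>x * S(\<nu>, x\<^sup>2)\<close>, and \<open>L\<^sub>\<nu>\<close> differs from it by an explicit positive factor.

  Monotonicity in \<open>\<nu>\<close> holds coefficient by coefficient.  So does log-convexity, because
  \<open>- ln (a)\<^sub>r\<close> is a sum of convex functions of \<open>\<nu>\<close>; it passes to the sum of the series by
  Hoelder's inequality (\<open>log_convex_on_suminf\<close>).

  Both statements on quotients are instances of one inequality (\<open>Binet_Cauchy_suminf_le\<close>): if
  \<open>p\<^sub>i / q\<^sub>i\<close> and \<open>u\<^sub>i / v\<^sub>i\<close> increase with \<open>i\<close>, then
  \<open>(\<Sum>i. p\<^sub>i v\<^sub>i) * (\<Sum>i. q\<^sub>i u\<^sub>i) \<le> (\<Sum>i. p\<^sub>i u\<^sub>i) * (\<Sum>i. q\<^sub>i v\<^sub>i)\<close>.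
  For the quotient of the orders \<open>\<mu> \<le> \<nu>\<close> as a function of \<open>y\<close>, take the two coefficient
  sequences as \<open>p\<close>, \<open>q\<close> and the powers of two values of \<open>y\<close> as \<open>u\<close>, \<open>v\<close>.
  For the quotient \<open>L\<^bsub>\<nu>+k\<^esub> / L\<^sub>\<nu>\<close>, note that \<open>a * (a + k)\<^sub>r = (a)\<^bsub>r+1\<^esub>\<close>, so
  that numerator and denominator are both series in \<open>u\<^sub>i = y ^ i / (a)\<^sub>i\<close>, with the shifted
  weights \<open>p\<^sub>i = w\<^bsub>i-1\<^esub>\<close> and the weights \<open>q\<^sub>i = w\<^sub>i\<close>.  Here \<open>p\<^sub>i / q\<^sub>i\<close> increases because
  \<open>w\<close> is log-concave, and the quotient of \<open>u\<^sub>i\<close> for two orders increases because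
  \<open>(b)\<^sub>i / (a)\<^sub>i\<close> does for \<open>a \<le> b\<close>.
\<close>

section \<open>The functional equation of the k-gamma function\<close>

definition k_pochhammer :: "real \<Rightarrow> real \<Rightarrow> nat \<Rightarrow> real" where
  "k_pochhammer k a r = (\<Prod>j<r. a + real j * k)"

lemma k_pochhammer_0 [simp]: "k_pochhammer k a 0 = 1"
  by (simp add: k_pochhammer_def)

lemma k_pochhammer_Suc: "k_pochhammer k a (Suc r) = k_pochhammer k a r * (a + real r * k)"
  by (simp add: k_pochhammer_def)

lemma k_pochhammer_Suc_left: "k_pochhammer k a (Suc r) = a * k_pochhammer k (a + k) r"
  by (simp add: k_pochhammer_def prod.lessThan_Suc_shift algebra_simps del: prod.lessThan_Suc)

lemma k_pochhammer_pos:
  assumes "k > 0" "a > 0"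
  shows "k_pochhammer k a r > 0"
  unfolding k_pochhammer_def using assms by (intro prod_pos) (auto intro!: add_pos_nonneg)

lemma k_pochhammer_mono:
  assumes "k > 0" "0 < a" "a \<le> b"
  shows "k_pochhammer k a r \<le> k_pochhammer k b r"
  unfolding k_pochhammer_def using assms by (intro prod_mono) auto

text \<open>For \<open>a \<le> b\<close> each step multiplies \<open>(b)\<^sub>i / (a)\<^sub>i\<close> by
  \<open>(b + i * k) / (a + i * k) \<ge> 1\<close>; the fractions are cleared to fit the cross-product
  inequality for sums.\<close>

lemma k_pochhammer_ratio_mono:
  assumes "k > 0" "0 < a" "a \<le> b" "j \<le> i"
  shows "k_pochhammer k b j * k_pochhammer k a i \<le> k_pochhammer k b i * k_pochhammer k a j"
  using \<open>j \<le> i\<close>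
proof (induction i rule: dec_induct)
  case base
  show ?case by simp
next
  case (step n)
  have nn: "0 \<le> k_pochhammer k b n * k_pochhammer k a j"
    using k_pochhammer_pos assms by (intro mult_nonneg_nonneg) (auto intro: less_imp_le)
  have "k_pochhammer k b j * k_pochhammer k a n * (a + real n * k)
      \<le> k_pochhammer k b n * k_pochhammer k a j * (b + real n * k)"
    using step.IH nn assms by (intro mult_mono[OF step.IH]) auto
  then show ?case by (simp add: k_pochhammer_Suc mult_ac)
qed

text \<open>The substitution \<open>s = t powr k / k\<close> turns Euler's integral into the one that defines the
  k-gamma function.\<close>

lemma k_Gamma_eq_Gamma:
  assumes "k > 0" "x > 0"
  shows "k_Gamma k x = k powr (x / k - 1) * Gamma (x / k)"
proof -
  define f where "f s = k powr (x / k - 1) * (s powr (x / k - 1) / exp s)" for s :: real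
  define g where "g t = t powr k / k" for t :: real
  define h where "h t = t powr (x - 1) * exp (- (t powr k / k))" for t :: real
  let ?c = "k powr (x / k - 1) * Gamma (x / k)"
  have "(f has_integral ?c) {0..}"
    unfolding f_def using assms by (intro has_integral_mult_right Gamma_integral_real) simp
  then have f_int: "(f has_integral ?c) {0<..}"
    by (subst has_integral_spike_set_eq[of _ "{0..}"]) (auto intro: negligible_subset[of "{0}"])
  have f_abs: "f absolutely_integrable_on {0<..}"
    using f_int by (intro nonnegative_absolutely_integrable_1) (auto simp: f_def)
  have der: "(g has_field_derivative t powr (k - 1)) (at t within {0<..})" if "t \<in> {0<..}" for t
    unfolding g_def using that assms by (auto intro!: derivative_eq_intros)
  have inj: "inj_on g {0<..}"
  proof (rule inj_onI)
    fix s t assume st: "s \<in> {0<..}" "t \<in> {0<..}" "g s = g t"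
    then have "s powr k = t powr k" using assms by (simp add: g_def)
    then have "(s powr k) powr (1 / k) = (t powr k) powr (1 / k)" by simp
    then show "s = t" using st assms by (simp add: powr_powr)
  qed
  have img: "g ` {0<..} = {0<..}"
  proof
    show "g ` {0<..} \<subseteq> {0<..}" using assms by (auto simp: g_def)
    show "{0<..} \<subseteq> g ` {0<..}"
    proof
      fix s :: real assume "s \<in> {0<..}"
      then have "s = g ((k * s) powr (1 / k))" "(k * s) powr (1 / k) \<in> {0<..}"
        using assms by (auto simp: g_def powr_powr)
      then show "s \<in> g ` {0<..}" by blast
    qed
  qed
  have h_eq: "\<bar>t powr (k - 1)\<bar> * f (g t) = h t" if "t \<in> {0<..}" for t
  proof -
    have "(k * g t) powr (x / k - 1) = t powr (x - k)"
      using that assms by (simp add: g_def powr_powr right_diff_distrib)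
    then have "f (g t) = t powr (x - k) * exp (- g t)"
      using that assms by (simp add: f_def g_def powr_mult[symmetric] exp_minus field_simps)
    moreover have "t powr (k - 1) * t powr (x - k) = t powr (x - 1)"
      by (simp add: powr_add[symmetric])
    ultimately show ?thesis
      by (simp add: h_def g_def mult.assoc[symmetric])
  qed
  have "(\<lambda>t. \<bar>t powr (k - 1)\<bar> * f (g t)) absolutely_integrable_on {0<..} \<and>
      integral {0<..} (\<lambda>t. \<bar>t powr (k - 1)\<bar> * f (g t)) = ?c"
    using f_abs f_int
    by (subst has_absolute_integral_change_of_variables_1'[OF _ der inj])
       (auto simp: img integral_unique)
  moreover have "(\<lambda>t. \<bar>t powr (k - 1)\<bar> * f (g t)) absolutely_integrable_on {0<..}
      \<longleftrightarrow> h absolutely_integrable_on {0<..}"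
    using h_eq by (intro set_integrable_cong) auto
  moreover have "integral {0<..} (\<lambda>t. \<bar>t powr (k - 1)\<bar> * f (g t)) = integral {0<..} h"
    using h_eq by (intro integral_cong) auto
  ultimately have h_abs: "h absolutely_integrable_on {0<..}" and h_int: "integral {0<..} h = ?c"
    by simp_all
  \<comment> \<open>The change of variables lives on Lebesgue measure, the definition on Borel measure.\<close>
  have "set_integrable lborel {0<..} h"
    using h_abs unfolding set_integrable_def
    by (subst (asm) integrable_completion) (auto simp: h_def)
  then have "(LBINT t:{0<..}. h t) = integral {0<..} h"
    by (rule set_borel_integral_eq_integral)
  then show ?thesis
    by (simp add: k_Gamma_def h_int flip: h_def)
qed

lemma k_Gamma_pos:
  assumes "k > 0" "x > 0"
  shows "k_Gamma k x > 0"
  using assms by (simp add: k_Gamma_eq_Gamma)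

lemma k_Gamma_add_period:
  assumes "k > 0" "x > 0"
  shows "k_Gamma k (x + k) = x * k_Gamma k x"
proof -
  have "x / k \<notin> \<int>\<^sub>\<le>\<^sub>0"
    using assms nonpos_Ints_nonpos[of "x / k"] divide_pos_pos[of x k] by linarith
  then have "Gamma (x / k + 1) = x / k * Gamma (x / k)"
    by (rule Gamma_plus1)
  moreover have "k powr (x / k) = k * k powr (x / k - 1)"
    using assms by (simp add: powr_diff)
  ultimately show ?thesis
    using assms by (simp add: k_Gamma_eq_Gamma add_divide_distrib)
qed

lemma k_Gamma_add_multiple:
  assumes "k > 0" "a > 0"
  shows "k_Gamma k (real r * k + a) = k_pochhammer k a r * k_Gamma k a"
proof (induction r)
  case 0
  show ?case by simp
next
  case (Suc r)
  have pos: "real r * k + a > 0"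
    using assms by (intro add_nonneg_pos) simp_all
  have "real (Suc r) * k + a = (real r * k + a) + k"
    by (simp add: algebra_simps)
  then have "k_Gamma k (real (Suc r) * k + a) = (real r * k + a) * k_Gamma k (real r * k + a)"
    by (simp only: k_Gamma_add_period[OF assms(1) pos])
  then show ?case
    unfolding Suc.IH k_pochhammer_Suc by (simp only: mult_ac add_ac)
qed

section \<open>The coefficients and their power series\<close>

text \<open>The part of a coefficient that does not depend on the order \<open>\<nu>\<close>.\<close>

definition struve_weight :: "nat \<Rightarrow> real" where
  "struve_weight r = 1 / (Gamma (real r + 3 / 2) * 2 ^ (2 * r + 1))"

lemma struve_weight_pos: "struve_weight r > 0"
  unfolding struve_weight_def by (intro divide_pos_pos mult_pos_pos Gamma_real_pos) auto

text \<open>The quotient of successive weights decreases with \<open>r\<close>: this is the log-concavity of the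
  weights.\<close>

lemma struve_weight_Suc:
  "struve_weight (Suc r) = struve_weight r / (4 * (real r + 3 / 2))"
proof -
  have "real r + 3 / 2 \<notin> \<int>\<^sub>\<le>\<^sub>0"
    using nonpos_Ints_nonpos[of "real r + 3 / 2"] by linarith
  then have "Gamma (real r + 3 / 2 + 1) = (real r + 3 / 2) * Gamma (real r + 3 / 2)"
    by (rule Gamma_plus1)
  then show ?thesis
    by (simp add: struve_weight_def add_ac)
qed

lemma struve_coeff_eq:
  assumes "k > 0" "\<nu> > - (3 * k / 2)"
  shows "struve_coeff k \<nu> r = struve_weight r / k_pochhammer k (\<nu> + 3 * k / 2) r"
proof -
  have pos: "\<nu> + 3 * k / 2 > 0" using assms by simp
  show ?thesis
    using k_Gamma_add_multiple[OF assms(1) pos, of r] k_Gamma_pos[OF assms(1) pos]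
    by (simp add: struve_coeff_def struve_weight_def add.assoc)
qed

lemma struve_coeff_pos:
  assumes "k > 0" "\<nu> > - (3 * k / 2)"
  shows "struve_coeff k \<nu> r > 0"
  using assms by (simp add: struve_coeff_eq struve_weight_pos k_pochhammer_pos)

text \<open>Successive coefficients have a quotient of at most \<open>1 / (a * (r + 1))\<close>, so an exponential
  series dominates.\<close>

lemma summable_struve_coeff:
  assumes "k > 0" "\<nu> > - (3 * k / 2)"
  shows "summable (\<lambda>r. struve_coeff k \<nu> r * y ^ r)"
proof -
  define a where "a = \<nu> + 3 * k / 2"
  have a: "a > 0" using assms by (simp add: a_def)
  define C where "C = struve_coeff k \<nu> 0"
  have bound: "struve_coeff k \<nu> r \<le> C * ((1 / a) ^ r / fact r)" for r
  proof (induction r)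
    case 0
    show ?case by (simp add: C_def)
  next
    case (Suc r)
    have pos: "a + real r * k > 0"
      using a assms(1) by (intro add_pos_nonneg) auto
    have den: "a * real (Suc r) \<le> (a + real r * k) * (4 * (real r + 3 / 2))"
      using a assms by (intro mult_mono) auto
    have "struve_coeff k \<nu> (Suc r)
        = struve_coeff k \<nu> r / ((a + real r * k) * (4 * (real r + 3 / 2)))"
      using assms by (simp add: struve_coeff_eq struve_weight_Suc k_pochhammer_Suc a_def mult_ac)
    also have "\<dots> \<le> struve_coeff k \<nu> r / (a * real (Suc r))"
      using struve_coeff_pos[OF assms, of r] a pos den
      by (intro divide_left_mono mult_pos_pos) auto
    also have "\<dots> \<le> C * ((1 / a) ^ r / fact r) / (a * real (Suc r))"
      using Suc.IH a by (intro divide_right_mono) auto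
    also have "\<dots> = C * ((1 / a) ^ Suc r / fact (Suc r))"
      by (simp add: field_simps)
    finally show ?case .
  qed
  have "norm (struve_coeff k \<nu> r * y ^ r) \<le> C * (inverse (fact r) * (\<bar>y\<bar> / a) ^ r)" for r
  proof -
    have "norm (struve_coeff k \<nu> r * y ^ r) = struve_coeff k \<nu> r * \<bar>y\<bar> ^ r"
      using struve_coeff_pos[OF assms, of r] by (simp add: abs_mult power_abs)
    also have "\<dots> \<le> C * ((1 / a) ^ r / fact r) * \<bar>y\<bar> ^ r"
      by (intro mult_right_mono bound) auto
    finally show ?thesis by (simp add: power_divide field_simps)
  qed
  then show ?thesis
    by (intro summable_comparison_test'[where N = 0, OF summable_mult[OF summable_exp]])
qed

text \<open>The series in \<open>y = x\<^sup>2\<close> that remains once a factor \<open>x\<close> is split off the normalized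
  function.  It has no zero on the nonnegative half-line, so quotients of it need no separate
  treatment at \<open>0\<close>.\<close>

definition struve_series :: "real \<Rightarrow> real \<Rightarrow> real \<Rightarrow> real" where
  "struve_series k \<nu> y = (\<Sum>r. struve_coeff k \<nu> r * y ^ r)"

lemma struve_series_pos:
  assumes "k > 0" "\<nu> > - (3 * k / 2)" "y \<ge> 0"
  shows "struve_series k \<nu> y > 0"
  unfolding struve_series_def
proof (rule suminf_pos2[where i = 0])
  show "summable (\<lambda>r. struve_coeff k \<nu> r * y ^ r)" using assms by (intro summable_struve_coeff)
  show "0 \<le> struve_coeff k \<nu> r * y ^ r" for r
    using assms struve_coeff_pos[of k \<nu> r] by auto
  show "0 < struve_coeff k \<nu> 0 * y ^ 0"
    using assms struve_coeff_pos[of k \<nu> 0] by simp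
qed

lemma isCont_struve_series:
  assumes "k > 0" "\<nu> > - (3 * k / 2)"
  shows "isCont (struve_series k \<nu>) y"
  unfolding struve_series_def [abs_def]
  using assms by (intro isCont_powser_converges_everywhere summable_struve_coeff)

lemma norm_struve_eq:
  assumes "k > 0" "\<nu> > - (3 * k / 2)"
  shows "norm_struve k \<nu> x = x * struve_series k \<nu> (x\<^sup>2)"
proof -
  have "x * struve_series k \<nu> (x\<^sup>2) = (\<Sum>r. x * (struve_coeff k \<nu> r * (x\<^sup>2) ^ r))"
    unfolding struve_series_def using assms
    by (intro suminf_mult[symmetric] summable_struve_coeff)
  then show ?thesis
    by (simp add: norm_struve_def power_mult[symmetric] mult_ac)
qed

lemma mod_struve_eq:
  assumes "k > 0" "\<nu> > - (3 * k / 2)" "x > 0"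
  shows "mod_struve k \<nu> x =
    (x / 2) powr (\<nu> / k) / k_Gamma k (\<nu> + 3 * k / 2) * (x * struve_series k \<nu> (x\<^sup>2))"
proof -
  let ?a = "\<nu> + 3 * k / 2"
  let ?c = "(x / 2) powr (\<nu> / k) / k_Gamma k ?a * x"
  have "k_Gamma k ?a > 0" using assms by (intro k_Gamma_pos) auto
  then have coeff: "1 / (k_Gamma k (real r * k + \<nu> + 3 * k / 2) * Gamma (real r + 3 / 2))
      = struve_coeff k \<nu> r * 2 ^ (2 * r + 1) / k_Gamma k ?a" for r
    by (simp add: struve_coeff_def)
  have pow: "(x / 2) powr (2 * real r + \<nu> / k + 1)
      = (x / 2) powr (\<nu> / k) * (x * (x\<^sup>2) ^ r) / 2 ^ (2 * r + 1)" for r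
  proof -
    have "(x / 2) powr (2 * real r + \<nu> / k + 1)
        = (x / 2) powr (\<nu> / k) * (x / 2) powr real (2 * r + 1)"
      by (simp add: powr_add[symmetric] add_ac)
    also have "(x / 2) powr real (2 * r + 1) = (x / 2) ^ (2 * r + 1)"
      using assms by (intro powr_realpow) auto
    finally show ?thesis by (simp add: power_divide power_mult)
  qed
  have "mod_struve k \<nu> x = (\<Sum>r. ?c * (struve_coeff k \<nu> r * (x\<^sup>2) ^ r))"
    unfolding mod_struve_def coeff pow by (simp add: mult_ac)
  also have "\<dots> = ?c * struve_series k \<nu> (x\<^sup>2)"
    unfolding struve_series_def using assms by (intro suminf_mult summable_struve_coeff)
  finally show ?thesis by (simp add: mult_ac)
qed

section \<open>Two inequalities for infinite sums\<close>

text \<open>By the Binet-Cauchy identity, twice the difference of the two sides is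
  \<open>\<Sum>i j. (p\<^sub>i q\<^sub>j - p\<^sub>j q\<^sub>i) * (u\<^sub>i v\<^sub>j - u\<^sub>j v\<^sub>i)\<close>, and the two factors of each term have the
  same sign.  Stating the hypotheses as cross products rather than monotone quotients allows zero
  entries, such as the leading zero of a shifted sequence.\<close>

lemma Binet_Cauchy_sum_le:
  fixes p q u v :: "nat \<Rightarrow> real"
  assumes pq: "\<And>i j. j \<le> i \<Longrightarrow> p j * q i \<le> p i * q j"
    and uv: "\<And>i j. j \<le> i \<Longrightarrow> u j * v i \<le> u i * v j"
  shows "(\<Sum>i<n. p i * v i) * (\<Sum>i<n. q i * u i) \<le> (\<Sum>i<n. p i * u i) * (\<Sum>i<n. q i * v i)"
proof -
  let ?D = "\<lambda>i j. p i * u i * (q j * v j) - p i * v i * (q j * u j)"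
  let ?S = "\<Sum>i<n. \<Sum>j<n. ?D i j"
  have "0 \<le> (\<Sum>i<n. \<Sum>j<n. (p i * q j - p j * q i) * (u i * v j - u j * v i))"
  proof (intro sum_nonneg)
    fix i j
    show "0 \<le> (p i * q j - p j * q i) * (u i * v j - u j * v i)"
    proof (cases "j \<le> i")
      case True
      then show ?thesis using pq uv by (intro mult_nonneg_nonneg) auto
    next
      case False
      then show ?thesis using pq[of i j] uv[of i j] by (intro mult_nonpos_nonpos) auto
    qed
  qed
  also have "\<dots> = (\<Sum>i<n. \<Sum>j<n. ?D i j + ?D j i)"
    by (intro sum.cong refl) (simp add: algebra_simps)
  also have "\<dots> = ?S + (\<Sum>i<n. \<Sum>j<n. ?D j i)"
    by (simp only: sum.distrib)
  also have "(\<Sum>i<n. \<Sum>j<n. ?D j i) = ?S"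
    by (rule sum.swap)
  finally have "0 \<le> ?S" by simp
  also have "?S = (\<Sum>i<n. p i * u i) * (\<Sum>j<n. q j * v j)
      - (\<Sum>i<n. p i * v i) * (\<Sum>j<n. q j * u j)"
    by (simp only: sum_subtractf sum_product)
  finally show ?thesis by simp
qed

lemma Binet_Cauchy_suminf_le:
  fixes p q u v :: "nat \<Rightarrow> real"
  assumes "\<And>i j. j \<le> i \<Longrightarrow> p j * q i \<le> p i * q j"
    and "\<And>i j. j \<le> i \<Longrightarrow> u j * v i \<le> u i * v j"
    and "summable (\<lambda>i. p i * u i)" "summable (\<lambda>i. p i * v i)"
    and "summable (\<lambda>i. q i * u i)" "summable (\<lambda>i. q i * v i)"
  shows "(\<Sum>i. p i * v i) * (\<Sum>i. q i * u i) \<le> (\<Sum>i. p i * u i) * (\<Sum>i. q i * v i)"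
proof (rule LIMSEQ_le)
  show "(\<lambda>n. (\<Sum>i<n. p i * v i) * (\<Sum>i<n. q i * u i))
      \<longlonglongrightarrow> (\<Sum>i. p i * v i) * (\<Sum>i. q i * u i)"
    using assms by (intro tendsto_mult summable_LIMSEQ)
  show "(\<lambda>n. (\<Sum>i<n. p i * u i) * (\<Sum>i<n. q i * v i))
      \<longlonglongrightarrow> (\<Sum>i. p i * u i) * (\<Sum>i. q i * v i)"
    using assms by (intro tendsto_mult summable_LIMSEQ)
qed (use Binet_Cauchy_sum_le[of p q u v, OF assms(1,2)] in blast)

text \<open>This is Hoelder's inequality \<open>(\<Sum>r. \<alpha>\<^sub>r powr (1 - t) * \<beta>\<^sub>r powr t) \<le>
  A powr (1 - t) * B powr t\<close>, with \<open>A\<close> and \<open>B\<close> the sums of \<open>\<alpha>\<close> and \<open>\<beta>\<close>: divide the terms by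
  \<open>A\<close> and \<open>B\<close>, apply Young's inequality to each, and sum.\<close>

lemma log_convex_on_suminf:
  fixes g :: "nat \<Rightarrow> real \<Rightarrow> real"
  assumes lc: "\<And>r. log_convex_on S (g r)"
    and sm: "\<And>s. s \<in> S \<Longrightarrow> summable (\<lambda>r. g r s)"
  shows "log_convex_on S (\<lambda>s. \<Sum>r. g r s)"
proof -
  have pos: "g r s > 0" if "s \<in> S" for r s
    using lc[of r] that by (simp add: log_convex_on_def)
  have conv: "convex_on S (\<lambda>s. ln (g r s))" for r
    using lc[of r] by (simp add: log_convex_on_def)
  then have "convex S" by (rule convex_on_imp_convex)
  have sum_pos: "(\<Sum>r. g r s) > 0" if "s \<in> S" for s
    using that pos sm by (intro suminf_pos) auto
  have "convex_on S (\<lambda>s. ln (\<Sum>r. g r s))"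
  proof (rule convex_onI)
    fix t x y :: real
    assume t: "0 < t" "t < 1" and x: "x \<in> S" and y: "y \<in> S"
    define z where "z = (1 - t) *\<^sub>R x + t *\<^sub>R y"
    have z: "z \<in> S"
      unfolding z_def using convexD_alt[OF \<open>convex S\<close> x y] t by simp
    define A B where "A = (\<Sum>r. g r x)" and "B = (\<Sum>r. g r y)"
    have AB: "A > 0" "B > 0" using sum_pos x y by (auto simp: A_def B_def)
    \<comment> \<open>\<open>exp m\<close> is the Hoelder bound \<open>A powr (1 - t) * B powr t\<close>.\<close>
    define m where "m = (1 - t) * ln A + t * ln B"
    have term_le: "g r z \<le> exp m * ((1 - t) / A * g r x + t / B * g r y)" for r
    proof -
      have "ln (g r z) \<le> (1 - t) * ln (g r x) + t * ln (g r y)"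
        unfolding z_def using t x y by (intro convex_onD[OF conv]) auto
      also have "\<dots> = m + ((1 - t) * ln (g r x / A) + t * ln (g r y / B))"
        using pos[OF x, of r] pos[OF y, of r] AB by (simp add: m_def ln_div algebra_simps)
      finally have "g r z \<le> exp (m + ((1 - t) * ln (g r x / A) + t * ln (g r y / B)))"
        using pos[OF z, of r] by (metis exp_le_cancel_iff exp_ln)
      also have "\<dots> = exp m * ((g r x / A) powr (1 - t) * (g r y / B) powr t)"
        using pos[OF x, of r] pos[OF y, of r] AB by (simp add: powr_def exp_add)
      also have "\<dots> \<le> exp m * ((1 - t) * (g r x / A) + t * (g r y / B))"
        using t pos[OF x, of r] pos[OF y, of r] AB
        by (intro mult_left_mono Youngs_inequality_0) auto
      finally show ?thesis by simp
    qed
    have "(\<lambda>r. exp m * ((1 - t) / A * g r x + t / B * g r y))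
        sums (exp m * ((1 - t) / A * A + t / B * B))"
      unfolding A_def B_def
      by (rule sums_mult[OF sums_add[OF sums_mult[OF summable_sums[OF sm[OF x]]]
            sums_mult[OF summable_sums[OF sm[OF y]]]]])
    then have "(\<Sum>r. g r z) \<le> exp m * ((1 - t) / A * A + t / B * B)"
      by (rule sums_le[OF term_le summable_sums[OF sm[OF z]]])
    then have "(\<Sum>r. g r z) \<le> exp m" using AB by simp
    then have "ln (\<Sum>r. g r z) \<le> m"
      using sum_pos[OF z] ln_le_cancel_iff[of "\<Sum>r. g r z" "exp m"] by simp
    then show "ln (\<Sum>r. g r ((1 - t) *\<^sub>R x + t *\<^sub>R y))
        \<le> (1 - t) * ln (\<Sum>r. g r x) + t * ln (\<Sum>r. g r y)"
      by (simp add: z_def m_def A_def B_def)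
  qed fact
  then show ?thesis using sum_pos by (simp add: log_convex_on_def)
qed

section \<open>Monotonicity and log-convexity in the order\<close>

lemma struve_coeff_antimono:
  assumes "k > 0" "\<mu> > - (3 * k / 2)" "\<mu> \<le> \<nu>"
  shows "struve_coeff k \<nu> r \<le> struve_coeff k \<mu> r"
proof -
  have "struve_weight r / k_pochhammer k (\<nu> + 3 * k / 2) r
      \<le> struve_weight r / k_pochhammer k (\<mu> + 3 * k / 2) r"
    using assms by (intro divide_left_mono k_pochhammer_mono mult_pos_pos k_pochhammer_pos)
      (auto intro: less_imp_le struve_weight_pos)
  then show ?thesis using assms by (simp add: struve_coeff_eq)
qed

lemma struve_series_antimono:
  assumes "k > 0" "\<mu> > - (3 * k / 2)" "\<mu> \<le> \<nu>" "y \<ge> 0"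
  shows "struve_series k \<nu> y \<le> struve_series k \<mu> y"
  unfolding struve_series_def using assms
  by (intro suminf_le mult_right_mono struve_coeff_antimono summable_struve_coeff) auto

text \<open>The logarithm is a constant minus a sum of terms \<open>ln (\<nu> + c)\<close>, each concave in \<open>\<nu>\<close>.\<close>

lemma log_convex_on_struve_coeff:
  assumes "k > 0"
  shows "log_convex_on {- (3 * k / 2)<..} (\<lambda>\<nu>. struve_coeff k \<nu> r)"
proof -
  let ?S = "{- (3 * k / 2)<..}"
  let ?f = "\<lambda>j \<nu>. \<nu> + 3 * k / 2 + real j * k"
  have fpos: "?f j \<nu> > 0" if "\<nu> \<in> ?S" for j \<nu>
  proof -
    have "\<nu> + 3 * k / 2 > 0" using that by simp
    then show ?thesis by (rule add_pos_nonneg) (use assms in simp)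
  qed
  have ln_eq: "ln (struve_coeff k \<nu> r) = ln (struve_weight r) - (\<Sum>j<r. ln (?f j \<nu>))"
    if "\<nu> \<in> ?S" for \<nu>
  proof -
    have "ln (k_pochhammer k (\<nu> + 3 * k / 2) r) = (\<Sum>j<r. ln (?f j \<nu>))"
      unfolding k_pochhammer_def by (rule ln_prod) (simp_all add: fpos[OF that, THEN less_imp_neq, symmetric])
    then show ?thesis
      using that assms struve_weight_pos[of r] k_pochhammer_pos[of k "\<nu> + 3 * k / 2" r]
      by (simp add: struve_coeff_eq ln_div)
  qed
  have "convex_on ?S (\<lambda>\<nu>. ln (struve_coeff k \<nu> r))"
  proof (rule convex_onI)
    fix t x y :: real
    assume t: "0 < t" "t < 1" and x: "x \<in> ?S" and y: "y \<in> ?S"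
    let ?z = "(1 - t) *\<^sub>R x + t *\<^sub>R y"
    have z: "?z \<in> ?S"
      using convexD_alt[of ?S x y t] x y t by simp
    have "(1 - t) * ln (?f j x) + t * ln (?f j y) \<le> ln (?f j ?z)" for j
    proof -
      have "(1 - t) * ln (?f j x) + t * ln (?f j y)
          \<le> ln ((1 - t) *\<^sub>R ?f j x + t *\<^sub>R ?f j y)"
        using t fpos[OF x, of j] fpos[OF y, of j] by (intro concave_onD[OF ln_concave]) auto
      also have "(1 - t) *\<^sub>R ?f j x + t *\<^sub>R ?f j y = ?f j ?z"
        by (simp add: field_simps)
      finally show ?thesis .
    qed
    then have "(\<Sum>j<r. (1 - t) * ln (?f j x) + t * ln (?f j y)) \<le> (\<Sum>j<r. ln (?f j ?z))"
      by (intro sum_mono)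
    then show "ln (struve_coeff k ?z r)
        \<le> (1 - t) * ln (struve_coeff k x r) + t * ln (struve_coeff k y r)"
      by (simp only: ln_eq[OF x] ln_eq[OF y] ln_eq[OF z] sum.distrib sum_distrib_left[symmetric])
         (simp add: algebra_simps)
  qed (rule convex_real_interval)
  then show ?thesis
    using assms struve_coeff_pos by (simp add: log_convex_on_def)
qed

lemma log_convex_on_mult_const:
  assumes "log_convex_on S g" "c > 0"
  shows "log_convex_on S (\<lambda>s. g s * c)"
proof -
  have pos: "\<forall>s\<in>S. g s > 0" and conv: "convex_on S (\<lambda>s. ln (g s))"
    using assms by (auto simp: log_convex_on_def)
  have ln_eq: "ln (g s * c) = ln (g s) + ln c" if "s \<in> S" for s
    using pos[rule_format, OF that] assms(2) by (simp add: ln_mult)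
  have "convex_on S (\<lambda>s. ln (g s * c))"
  proof (rule convex_onI)
    show "convex S" using conv by (rule convex_on_imp_convex)
    fix t x y :: real
    assume t: "0 < t" "t < 1" and x: "x \<in> S" and y: "y \<in> S"
    have "(1 - t) *\<^sub>R x + t *\<^sub>R y \<in> S"
      using convexD_alt[OF \<open>convex S\<close> x y] t by simp
    moreover have "ln (g ((1 - t) *\<^sub>R x + t *\<^sub>R y)) \<le> (1 - t) * ln (g x) + t * ln (g y)"
      using t x y by (intro convex_onD[OF conv]) auto
    ultimately show "ln (g ((1 - t) *\<^sub>R x + t *\<^sub>R y) * c)
        \<le> (1 - t) * ln (g x * c) + t * ln (g y * c)"
      by (simp only: ln_eq x y) (simp add: algebra_simps)
  qed
  then show ?thesis
    using pos assms(2) by (simp add: log_convex_on_def)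
qed

lemma log_convex_on_norm_struve:
  assumes "k > 0" "x > 0"
  shows "log_convex_on {- (3 * k / 2)<..} (\<lambda>\<nu>. norm_struve k \<nu> x)"
  unfolding norm_struve_def
proof (rule log_convex_on_suminf)
  fix r
  show "log_convex_on {- (3 * k / 2)<..} (\<lambda>\<nu>. struve_coeff k \<nu> r * x ^ (2 * r + 1))"
    using assms by (intro log_convex_on_mult_const log_convex_on_struve_coeff) auto
next
  fix \<nu> assume "\<nu> \<in> {- (3 * k / 2)<..}"
  then have "summable (\<lambda>r. x * (struve_coeff k \<nu> r * (x\<^sup>2) ^ r))"
    using assms by (intro summable_mult summable_struve_coeff) auto
  then show "summable (\<lambda>r. struve_coeff k \<nu> r * x ^ (2 * r + 1))"
    by (simp add: power_mult[symmetric] mult_ac)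
qed

section \<open>Monotonicity of the quotients\<close>

text \<open>A quotient of power series increases when the quotient of their coefficients does; for
  the orders \<open>\<mu> \<le> \<nu>\<close> the latter is \<open>(b)\<^sub>i / (a)\<^sub>i\<close> with \<open>a \<le> b\<close>.\<close>

lemma struve_series_quot_mono:
  assumes "k > 0" "\<mu> > - (3 * k / 2)" "\<mu> \<le> \<nu>" "0 \<le> y" "y \<le> z"
  shows "struve_series k \<mu> y / struve_series k \<nu> y \<le> struve_series k \<mu> z / struve_series k \<nu> z"
proof -
  have \<nu>: "\<nu> > - (3 * k / 2)" using assms by simp
  have "struve_series k \<mu> y * struve_series k \<nu> z \<le> struve_series k \<mu> z * struve_series k \<nu> y"
    unfolding struve_series_def
  proof (rule Binet_Cauchy_suminf_le)
    fix i j :: nat assume "j \<le> i"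
    have "k_pochhammer k (\<nu> + 3 * k / 2) j * k_pochhammer k (\<mu> + 3 * k / 2) i
        \<le> k_pochhammer k (\<nu> + 3 * k / 2) i * k_pochhammer k (\<mu> + 3 * k / 2) j"
      using assms \<open>j \<le> i\<close> by (intro k_pochhammer_ratio_mono) auto
    then show "struve_coeff k \<mu> j * struve_coeff k \<nu> i \<le> struve_coeff k \<mu> i * struve_coeff k \<nu> j"
      using assms \<nu> struve_weight_pos[of i] struve_weight_pos[of j]
        k_pochhammer_pos[of k "\<nu> + 3 * k / 2"] k_pochhammer_pos[of k "\<mu> + 3 * k / 2"]
      by (simp add: struve_coeff_eq divide_simps mult_ac)
    \<comment> \<open>Cross-product form of the monotonicity of \<open>(z / y) ^ i\<close>, valid for \<open>y = 0\<close> as well.\<close>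
    have "(y * z) ^ j * y ^ (i - j) \<le> (y * z) ^ j * z ^ (i - j)"
      using assms by (intro mult_left_mono power_mono) auto
    then show "z ^ j * y ^ i \<le> z ^ i * y ^ j"
      using \<open>j \<le> i\<close> power_add[of y j "i - j"] power_add[of z j "i - j"]
      by (simp add: power_mult_distrib mult_ac)
  qed (use assms \<nu> in \<open>auto intro: summable_struve_coeff\<close>)
  then show ?thesis
    using struve_series_pos[of k \<nu>] assms \<nu> by (simp add: divide_simps mult_ac)
qed

text \<open>The quotient of the two series is continuous at \<open>0\<close>, so its value there is the limit that
  fills the removable singularity.\<close>

lemma norm_struve_quot_eq:
  assumes "k > 0" "\<mu> > - (3 * k / 2)" "\<nu> > - (3 * k / 2)"
  shows "norm_struve_quot k \<mu> \<nu> x = struve_series k \<mu> (x\<^sup>2) / struve_series k \<nu> (x\<^sup>2)"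
proof (cases "x = 0")
  case True
  let ?Q = "\<lambda>t. struve_series k \<mu> (t\<^sup>2) / struve_series k \<nu> (t\<^sup>2)"
  have cont: "isCont (\<lambda>t. struve_series k \<rho> (t\<^sup>2)) 0" if "\<rho> > - (3 * k / 2)" for \<rho>
    using assms that by (intro isCont_o2[OF _ isCont_struve_series]) auto
  have "isCont ?Q 0"
    using assms struve_series_pos[of k \<nu> 0] by (intro isCont_divide cont) auto
  then have "(?Q \<longlongrightarrow> ?Q 0) (at 0)" by (simp add: isCont_def)
  moreover have "eventually (\<lambda>t. ?Q t = norm_struve k \<mu> t / norm_struve k \<nu> t) (at 0)"
    using assms by (auto simp: norm_struve_eq eventually_at_filter)
  ultimately have "((\<lambda>t. norm_struve k \<mu> t / norm_struve k \<nu> t) \<longlongrightarrow> ?Q 0) (at 0)"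
    by (rule Lim_transform_eventually)
  then show ?thesis
    using True by (simp add: norm_struve_quot_def tendsto_Lim)
next
  case False
  then show ?thesis
    using assms by (simp add: norm_struve_quot_def norm_struve_eq)
qed

text \<open>Log-convexity in the order makes \<open>S(\<nu> + k, y) / S(\<nu>, y)\<close> increase with \<open>\<nu>\<close>, so the
  factor \<open>1 / a\<close> has to outweigh that growth.  It is absorbed into the numerator through
  \<open>a * (a + k)\<^sub>r = (a)\<^bsub>r+1\<^esub>\<close>, after which \<open>y / a * S(\<nu> + k, y)\<close> is a series in
  \<open>y ^ i / (a)\<^sub>i\<close> just as \<open>S(\<nu>, y)\<close> is.\<close>

lemma struve_series_shift_quot_antimono:
  assumes "k > 0" "\<mu> > - (3 * k / 2)" "\<mu> \<le> \<nu>" "y > 0"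
  shows "struve_series k (\<nu> + k) y / ((\<nu> + 3 * k / 2) * struve_series k \<nu> y)
       \<le> struve_series k (\<mu> + k) y / ((\<mu> + 3 * k / 2) * struve_series k \<mu> y)"
proof -
  have \<nu>: "\<nu> > - (3 * k / 2)" using assms by simp
  let ?a = "\<lambda>\<rho>. \<rho> + 3 * k / 2"
  \<comment> \<open>Multiplication by \<open>y\<close> shifts the weights by one place; the vacant place gets \<open>0\<close>.\<close>
  define p where "p i = (if i = 0 then 0 else struve_weight (i - 1))" for i
  define u where "u \<rho> i = y ^ i / k_pochhammer k (?a \<rho>) i" for \<rho> i
  have weight_sums: "(\<lambda>i. struve_weight i * u \<rho> i) sums struve_series k \<rho> y"
    if "\<rho> > - (3 * k / 2)" for \<rho>
    using summable_sums[OF summable_struve_coeff[OF assms(1) that, of y]] that assms(1)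
    by (simp add: struve_series_def u_def struve_coeff_eq)
  have p_sums: "(\<lambda>i. p i * u \<rho> i) sums (y / ?a \<rho> * struve_series k (\<rho> + k) y)"
    if "\<rho> > - (3 * k / 2)" for \<rho>
  proof -
    have "(\<lambda>r. struve_coeff k (\<rho> + k) r * y ^ r) sums struve_series k (\<rho> + k) y"
      unfolding struve_series_def using that assms(1)
      by (intro summable_sums summable_struve_coeff) auto
    then have "(\<lambda>r. y / ?a \<rho> * (struve_coeff k (\<rho> + k) r * y ^ r))
        sums (y / ?a \<rho> * struve_series k (\<rho> + k) y)"
      by (rule sums_mult)
    moreover have "y / ?a \<rho> * (struve_coeff k (\<rho> + k) r * y ^ r) = p (Suc r) * u \<rho> (Suc r)" for r
    proof -
      have "\<rho> + k + 3 * k / 2 = ?a \<rho> + k" by simp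
      then show ?thesis
        using that assms(1) by (simp add: struve_coeff_eq p_def u_def k_pochhammer_Suc_left)
    qed
    ultimately have "(\<lambda>r. p (Suc r) * u \<rho> (Suc r)) sums (y / ?a \<rho> * struve_series k (\<rho> + k) y)"
      by simp
    then show ?thesis
      by (subst (asm) sums_Suc_iff) (simp add: p_def)
  qed
  have "(\<Sum>i. p i * u \<nu> i) * (\<Sum>i. struve_weight i * u \<mu> i)
      \<le> (\<Sum>i. p i * u \<mu> i) * (\<Sum>i. struve_weight i * u \<nu> i)"
  proof (rule Binet_Cauchy_suminf_le)
    fix i j :: nat assume ij: "j \<le> i"
    \<comment> \<open>For positive indices this is the log-concavity of the weights.\<close>
    show "p j * struve_weight i \<le> p i * struve_weight j"
    proof (cases j)
      case 0
      then show ?thesis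
        using struve_weight_pos by (simp add: p_def less_imp_le)
    next
      case (Suc j')
      then obtain i' where i': "i = Suc i'" "j' \<le> i'" using ij by (cases i) auto
      have "struve_weight j' * struve_weight i' / (4 * (real i' + 3 / 2))
          \<le> struve_weight j' * struve_weight i' / (4 * (real j' + 3 / 2))"
        using i' struve_weight_pos[of i'] struve_weight_pos[of j']
        by (intro divide_left_mono) auto
      then show ?thesis
        by (simp add: Suc i' p_def struve_weight_Suc mult_ac)
    qed
    have "k_pochhammer k (?a \<nu>) j * k_pochhammer k (?a \<mu>) i
        \<le> k_pochhammer k (?a \<nu>) i * k_pochhammer k (?a \<mu>) j"
      using assms ij by (intro k_pochhammer_ratio_mono) auto
    then show "u \<mu> j * u \<nu> i \<le> u \<mu> i * u \<nu> j"
      using assms \<nu> k_pochhammer_pos[of k "?a \<nu>"] k_pochhammer_pos[of k "?a \<mu>"]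
      by (simp add: u_def divide_simps mult_ac)
  qed (use weight_sums p_sums assms(2) \<nu> in \<open>auto simp: sums_iff\<close>)
  then have "y / ?a \<nu> * struve_series k (\<nu> + k) y * struve_series k \<mu> y
      \<le> y / ?a \<mu> * struve_series k (\<mu> + k) y * struve_series k \<nu> y"
    using weight_sums p_sums assms(2) \<nu> by (simp add: sums_iff)
  then have "y * (struve_series k (\<nu> + k) y / ?a \<nu> * struve_series k \<mu> y)
      \<le> y * (struve_series k (\<mu> + k) y / ?a \<mu> * struve_series k \<nu> y)"
    by (simp add: mult_ac)
  then have le: "struve_series k (\<nu> + k) y / ?a \<nu> * struve_series k \<mu> y
      \<le> struve_series k (\<mu> + k) y / ?a \<mu> * struve_series k \<nu> y"
    by (rule mult_left_le_imp_le) (fact assms(4))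
  have "A / c \<le> B / d" if "A * d \<le> B * c" "c > 0" "d > 0" for A B c d :: real
    using that by (simp add: divide_simps)
  from this[OF le]
  have "struve_series k (\<nu> + k) y / ?a \<nu> / struve_series k \<nu> y
      \<le> struve_series k (\<mu> + k) y / ?a \<mu> / struve_series k \<mu> y"
    using assms \<nu> by (simp add: struve_series_pos)
  then show ?thesis by simp
qed

lemma mod_struve_shift_quot:
  assumes "k > 0" "\<nu> > - (3 * k / 2)" "x > 0"
  shows "mod_struve k (\<nu> + k) x / mod_struve k \<nu> x
    = x / 2 * (struve_series k (\<nu> + k) (x\<^sup>2) / ((\<nu> + 3 * k / 2) * struve_series k \<nu> (x\<^sup>2)))"
proof -
  let ?a = "\<nu> + 3 * k / 2"
  have a: "?a > 0" using assms by simp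
  have "k_Gamma k (\<nu> + k + 3 * k / 2) = ?a * k_Gamma k ?a"
    using k_Gamma_add_period[OF assms(1) a] by (simp add: add_ac)
  moreover have "(x / 2) powr ((\<nu> + k) / k) = (x / 2) powr (\<nu> / k) * (x / 2)"
    using assms by (simp add: add_divide_distrib powr_add)
  ultimately show ?thesis
    using assms a k_Gamma_pos[OF assms(1) a] struve_series_pos[of k \<nu> "x\<^sup>2"]
    by (simp add: mod_struve_eq del: times_divide_eq_right) (simp add: field_simps)
qed

theorem theorem2p1:
  fixes k :: real
  assumes "k > 0"
  shows "(\<forall>\<mu> \<nu>. \<nu> \<ge> \<mu> \<and> \<mu> > - (3 * k / 2) \<longrightarrow>
            mono_on {0..} (norm_struve_quot k \<mu> \<nu>) \<and>
            antimono_on {..0} (norm_struve_quot k \<mu> \<nu>))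
       \<and> (\<forall>x. x \<ge> 0 \<longrightarrow> antimono_on {- (3 * k / 2)<..} (\<lambda>\<nu>. norm_struve k \<nu> x))
       \<and> (\<forall>x. x < 0 \<longrightarrow> mono_on {- (3 * k / 2)<..} (\<lambda>\<nu>. norm_struve k \<nu> x))
       \<and> (\<forall>x. x > 0 \<longrightarrow> log_convex_on {- (3 * k / 2)<..} (\<lambda>\<nu>. norm_struve k \<nu> x))
       \<and> (\<forall>x. x > 0 \<longrightarrow> antimono_on {- (3 * k / 2)<..}
            (\<lambda>\<nu>. mod_struve k (\<nu> + k) x / mod_struve k \<nu> x))"
proof (intro conjI allI impI)
  fix \<mu> \<nu> assume "\<nu> \<ge> \<mu> \<and> \<mu> > - (3 * k / 2)"
  then have ord: "\<mu> \<le> \<nu>" "\<mu> > - (3 * k / 2)" "\<nu> > - (3 * k / 2)" by auto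
  have quot_le: "norm_struve_quot k \<mu> \<nu> x \<le> norm_struve_quot k \<mu> \<nu> y" if "x\<^sup>2 \<le> y\<^sup>2" for x y
    unfolding norm_struve_quot_eq[OF assms ord(2,3)]
    using assms ord that by (intro struve_series_quot_mono) auto
  show "mono_on {0..} (norm_struve_quot k \<mu> \<nu>)"
    by (intro mono_onI quot_le power_mono) auto
  show "antimono_on {..0} (norm_struve_quot k \<mu> \<nu>)"
    by (intro monotone_onI quot_le) (auto simp flip: abs_le_square_iff)
next
  fix x :: real assume "x \<ge> 0"
  then show "antimono_on {- (3 * k / 2)<..} (\<lambda>\<nu>. norm_struve k \<nu> x)"
    using assms
    by (intro monotone_onI) (simp add: norm_struve_eq mult_left_mono struve_series_antimono)
next
  fix x :: real assume "x < 0"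
  then show "mono_on {- (3 * k / 2)<..} (\<lambda>\<nu>. norm_struve k \<nu> x)"
    using assms by (intro mono_onI) (simp add: norm_struve_eq struve_series_antimono)
next
  fix x :: real assume "x > 0"
  then show "log_convex_on {- (3 * k / 2)<..} (\<lambda>\<nu>. norm_struve k \<nu> x)"
    using assms by (intro log_convex_on_norm_struve)
next
  fix x :: real assume "x > 0"
  then show "antimono_on {- (3 * k / 2)<..} (\<lambda>\<nu>. mod_struve k (\<nu> + k) x / mod_struve k \<nu> x)"
    using assms
    by (intro monotone_onI)
       (simp add: mod_struve_shift_quot struve_series_shift_quot_antimono mult_left_mono
          del: times_divide_eq_left times_divide_eq_right)
qed

end
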